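(* Let $b$ and $b'$ be two multiplicatively independent integers greater than $1$ and let $n\ge 1$. A compact set $X\subset[0,1]^n$ is simultaneously $b$-self-similar and $b'$-self-similar if and only if it is a finite union of polyhedra whose vertices have rational coordinates.
   Context: Two real numbers $\beta,\gamma>1$ are multiplicatively independent if $\frac{\log\beta}{\log\gamma}\notin\mathbb{Q}$. Let $b\ge 2$ be an integer. The $b$-kernel of a compact set $X\subset[0,1]^n$ is the collection of sets $$\left\{(b^kX-\mathbf{a})\cap[0,1]^n \;\middle|\; k\ge 0,\ \mathbf{a}=(a_1,\ldots,a_n)\in\mathbb{Z}^n,\ 0\le a_i<b^k \text{ for all } i\right\},$$ where $b^kX-\mathbf{a}=\{b^k\mathbf{x}-\mathbf{a}\mid\mathbf{x}\in X\}$. The compact set $X$ is $b$-self-similar if its $b$-kernel is finite (as a collection of sets). Here a polyhedron is a compact convex polytope of any dimension (possibly lower-dimensional, including a single point), i.e. the convex hull of a finite set of points; a finite union may be empty. *)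

theory Defs
  imports "HOL-Analysis.Analysis"
begin

definition mult_independent :: "real \<Rightarrow> real \<Rightarrow> bool" where
  "mult_independent \<beta> \<gamma> \<longleftrightarrow> \<beta> > 1 \<and> \<gamma> > 1 \<and> ln \<beta> / ln \<gamma> \<notin> \<rat>"

(* In real ^ 'n the constant 1 is the all-ones vector, so cbox 0 1 is the unit cube [0,1]^n. *)
abbreviation unit_cube :: "(real ^ 'n) set" where
  "unit_cube \<equiv> cbox 0 1"

definition real_vec :: "int ^ 'n \<Rightarrow> real ^ 'n" where
  "real_vec a = (\<chi> i. real_of_int (a $ i))"

definition b_kernel :: "nat \<Rightarrow> (real ^ 'n) set \<Rightarrow> (real ^ 'n) set set" where
  "b_kernel b X =
    {(\<lambda>x. real b ^ k *\<^sub>R x - real_vec a) ` X \<inter> unit_cube | k a.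
       \<forall>i. 0 \<le> a $ i \<and> a $ i < int b ^ k}"

definition b_self_similar :: "nat \<Rightarrow> (real ^ 'n) set \<Rightarrow> bool" where
  "b_self_similar b X \<longleftrightarrow> finite (b_kernel b X)"

(* A polyhedron is a library polytope (the library's polyhedron may be unbounded); its vertices
   are its extreme points. The empty polytope is allowed, which does not affect finite unions. *)
definition rational_polytope :: "(real ^ 'n) set \<Rightarrow> bool" where
  "rational_polytope P \<longleftrightarrow>
    polytope P \<and> (\<forall>v. v extreme_point_of P \<longrightarrow> (\<forall>i. v $ i \<in> \<rat>))"

end

theory Submission
  imports Defs
begin

text \<open>
  Both directions are about how X looks at scale \<open>b\<^sup>-\<^sup>k\<close> around a lattice point, that is, about
  its views \<open>b\<^sup>k X - a\<close> cut down to the window \<open>[-3, 3]\<^sup>n\<close>. Finiteness of the kernel is the same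
  as finiteness of the set of views, but views are more convenient: the lattice vector is
  unrestricted, there is room around the unit cube, and finiteness is preserved by unions and
  intersections.

  Suppose that X has finitely many views in both bases.

  At a rational point q the position of q inside its cell takes finitely many values, so infinitely
  many k give the same picture of X around q in base b and, at a comparable scale
  \<open>b'\<^sup>m \<le> b\<^sup>k < b'\<^sup>m\<^sup>+\<^sup>1\<close>, also in base b'. The ratios \<open>b\<^sup>k / b'\<^sup>m\<close> lie in a bounded interval
  and are pairwise distinct by multiplicative independence, so quotients of two of them come
  arbitrarily close to 1 and leave X invariant near q. As X is closed, X is a cone with apex q in
  some neighbourhood of q (\<open>rational_point_conical\<close>).

  The size of that neighbourhood is not controlled, but one base suffices to control it. Around
  an arbitrary point x two views at scales \<open>k < l\<close> coincide, and this says that X is invariant, in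
  a cube of radius \<open>2 / b\<^sup>k\<close>, under the contraction with ratio \<open>b\<^sup>k\<^sup>-\<^sup>l\<close> that carries one cell of x
  to the other. Its fixed point q is rational, hence X is a cone near q, and expanding
  by the contraction turns this into a cone in the whole cube around q, which contains x
  (\<open>rational_conical_neighbourhood\<close>).

  Finitely many such cubes cover X. In each of them X is the cone over its intersection with the
  faces of the cube; this intersection satisfies the same assumptions and lives in fewer
  dimensions, so it is a finite union of rational polytopes by induction, and so is the cone
  (\<open>rational_polytopal_if_finite_views\<close>).

  Conversely, a rational polytope is a finite intersection of rational half-spaces
  (\<open>rational_polyhedron_convex_hull\<close>), and a half-space with integer coefficients, seen in a
  bounded window, is determined by one integer from a bounded range
  (\<open>finite_views_halfspace\<close>).
\<close>

section \<open>Rational points and rational polytopes\<close>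

definition rational_point :: "real ^ 'n \<Rightarrow> bool" where
  "rational_point v \<longleftrightarrow> (\<forall>i. v $ i \<in> \<rat>)"

lemma rational_polytope_iff:
  "rational_polytope P \<longleftrightarrow>
    (\<exists>S. finite S \<and> (\<forall>v\<in>S. rational_point v) \<and> P = convex hull S)"
proof
  assume P: "rational_polytope P"
  then have "polytope P" by (simp add: rational_polytope_def)
  then obtain S where S: "finite S" "P = convex hull S" by (auto simp: polytope_def)
  then have "{v. v extreme_point_of P} \<subseteq> S" using extreme_points_of_convex_hull by blast
  then have "finite {v. v extreme_point_of P}" using S(1) finite_subset by blast
  moreover have "P = convex hull {v. v extreme_point_of P}"
    using \<open>polytope P\<close> by (intro Krein_Milman_Minkowski polytope_imp_compact polytope_imp_convex)
  ultimately
  show "\<exists>S. finite S \<and> (\<forall>v\<in>S. rational_point v) \<and> P = convex hull S"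
    using P unfolding rational_polytope_def rational_point_def by blast
next
  assume "\<exists>S. finite S \<and> (\<forall>v\<in>S. rational_point v) \<and> P = convex hull S"
  then show "rational_polytope P"
    unfolding rational_polytope_def rational_point_def polytope_def
    using extreme_point_of_convex_hull by blast
qed

lemma common_denominator:
  assumes "finite (S :: real set)" "S \<subseteq> \<rat>"
  shows "\<exists>d::nat. d > 0 \<and> (\<forall>x\<in>S. real d * x \<in> \<int>)"
  using assms
proof (induction S)
  case empty
  show ?case by (rule exI[of _ 1]) simp
next
  case (insert x S)
  then obtain d where d: "d > 0" "\<forall>x\<in>S. real d * x \<in> \<int>" by auto
  from insert.prems have "x \<in> \<rat>" by simp
  then obtain m :: int and e :: nat where e: "e \<noteq> 0" "x = of_int m / of_nat e"
    unfolding Rats_eq_int_div_nat by auto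
  have "real (d * e) * y \<in> \<int>" if "y \<in> insert x S" for y
  proof (cases "y = x")
    case True
    have "real (d * e) * x = of_int (int d * m)" using e by simp
    then show ?thesis unfolding True by (simp only: Ints_of_int)
  next
    case False
    then have "real d * y \<in> \<int>" using that d(2) by blast
    then have "real e * (real d * y) \<in> \<int>" by (rule Ints_mult[OF Ints_of_nat])
    moreover have "real (d * e) * y = real e * (real d * y)" by simp
    ultimately show ?thesis by (simp only:)
  qed
  then show ?case using d e by (intro exI[of _ "d * e"]) auto
qed

lemma finite_vectors:
  assumes "\<And>i::'n::finite. finite (B i)"
  shows "finite {v :: 'a ^ 'n. \<forall>i. v $ i \<in> B i}"
proof -
  have "{v :: 'a ^ 'n. \<forall>i. v $ i \<in> B i} \<subseteq> vec_lambda ` (PiE UNIV B)"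
  proof
    fix v :: "'a ^ 'n" assume "v \<in> {v. \<forall>i. v $ i \<in> B i}"
    then show "v \<in> vec_lambda ` (PiE UNIV B)"
      by (intro image_eqI[of _ _ "vec_nth v"]) auto
  qed
  moreover have "finite (PiE UNIV B)" using assms by (intro finite_PiE) auto
  ultimately show ?thesis using finite_surj by blast
qed

section \<open>Views\<close>

definition cube :: "real \<Rightarrow> (real ^ 'n) set" where
  "cube r = {y. \<forall>i. \<bar>y $ i\<bar> \<le> r}"

abbreviation window :: "(real ^ 'n) set" where
  "window \<equiv> cube 3"

text \<open>
  The radius 3 of the window leaves room for a cube of radius 2 around every point of the unit
  cube; \<open>rational_conical_neighbourhood\<close> needs exactly that.
\<close>
definition view :: "nat \<Rightarrow> (real ^ 'n) set \<Rightarrow> nat \<Rightarrow> int ^ 'n \<Rightarrow> (real ^ 'n) set" where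
  "view b X k a = {y \<in> window. (1 / real b ^ k) *\<^sub>R (y + real_vec a) \<in> X}"

definition finite_views :: "nat \<Rightarrow> (real ^ 'n) set \<Rightarrow> bool" where
  "finite_views b X \<longleftrightarrow> finite {view b X k a | k a. True}"

lemma real_vec_nth [simp]: "real_vec a $ i = real_of_int (a $ i)"
  by (simp add: real_vec_def)

lemma finite_views_Int:
  assumes "finite_views b X" "finite_views b Y"
  shows "finite_views b (X \<inter> Y)"
proof -
  have "{view b (X \<inter> Y) k a | k a. True} \<subseteq>
     (\<lambda>(A, B). A \<inter> B) ` ({view b X k a | k a. True} \<times> {view b Y k a | k a. True})"
  proof clarify
    fix k a
    have "view b (X \<inter> Y) k a = view b X k a \<inter> view b Y k a" by (auto simp: view_def)
    then show "view b (X \<inter> Y) k a \<in>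
       (\<lambda>(A, B). A \<inter> B) ` ({view b X k a | k a. True} \<times> {view b Y k a | k a. True})"
      by (intro image_eqI[of _ _ "(view b X k a, view b Y k a)"]) auto
  qed
  then show ?thesis using assms unfolding finite_views_def
    by (meson finite_SigmaI finite_imageI finite_subset)
qed

lemma finite_views_Un:
  assumes "finite_views b X" "finite_views b Y"
  shows "finite_views b (X \<union> Y)"
proof -
  have "{view b (X \<union> Y) k a | k a. True} \<subseteq>
     (\<lambda>(A, B). A \<union> B) ` ({view b X k a | k a. True} \<times> {view b Y k a | k a. True})"
  proof clarify
    fix k a
    have "view b (X \<union> Y) k a = view b X k a \<union> view b Y k a" by (auto simp: view_def)
    then show "view b (X \<union> Y) k a \<in>
       (\<lambda>(A, B). A \<union> B) ` ({view b X k a | k a. True} \<times> {view b Y k a | k a. True})"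
      by (intro image_eqI[of _ _ "(view b X k a, view b Y k a)"]) auto
  qed
  then show ?thesis using assms unfolding finite_views_def
    by (meson finite_SigmaI finite_imageI finite_subset)
qed

lemma finite_views_empty [simp]: "finite_views b {}"
proof -
  have "{view b {} k a | k a. True} \<subseteq> {{}}" by (auto simp: view_def)
  then show ?thesis unfolding finite_views_def using finite_subset by blast
qed

lemma finite_views_UNIV [simp]: "finite_views b UNIV"
proof -
  have "{view b UNIV k a | k a. True} \<subseteq> {window}" by (auto simp: view_def)
  then show ?thesis unfolding finite_views_def using finite_subset by blast
qed

lemma finite_views_Union:
  assumes "finite \<P>" "\<And>P. P \<in> \<P> \<Longrightarrow> finite_views b P"
  shows "finite_views b (\<Union>\<P>)"
  using assms by (induction \<P>) (auto intro: finite_views_Un)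

text \<open>
  The window is covered by the unit cells with corners in \<open>{-4..3}\<^sup>n\<close>, so a view is glued from
  a bounded number of kernel elements. Cells outside the range admitted in the kernel can be
  skipped: as X lies in the unit cube, each point of X also lies in an admitted cell.
\<close>
lemma finite_views_if_b_self_similar:
  fixes X :: "(real ^ 'n) set"
  assumes "b > 0" "X \<subseteq> unit_cube" "b_self_similar b X"
  shows "finite_views b X"
proof -
  define cells :: "(int ^ 'n) set" where "cells = {c. \<forall>i. c $ i \<in> {-4..3}}"
  have fin_cells: "finite cells" unfolding cells_def by (rule finite_vectors) simp
  define piece where "piece k a = (\<lambda>x. real b ^ k *\<^sub>R x - real_vec a) ` X \<inter> unit_cube" for k a
  define glue where
    "glue G = (\<Union>c\<in>cells. window \<inter> (\<lambda>z. real_vec c + z) ` G c)" for G :: "int ^ 'n \<Rightarrow> (real ^ 'n) set"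
  have "{view b X k a | k a. True} \<subseteq> glue ` (PiE cells (\<lambda>_. insert {} (b_kernel b X)))"
  proof clarify
    fix k a
    define G where "G = restrict (\<lambda>c. if \<forall>i. 0 \<le> (a + c) $ i \<and> (a + c) $ i < int b ^ k
         then piece k (a + c) else {}) cells"
    have "G \<in> PiE cells (\<lambda>_. insert {} (b_kernel b X))"
    proof (intro PiE_I)
      fix c
      show "G c \<in> insert {} (b_kernel b X)" if "c \<in> cells"
      proof (cases "\<forall>i. 0 \<le> (a + c) $ i \<and> (a + c) $ i < int b ^ k")
        case True
        then have "piece k (a + c) \<in> b_kernel b X" unfolding b_kernel_def piece_def by blast
        then show ?thesis using True that by (simp add: G_def)
      next
        case False
        then have "G c = {}" using that unfolding G_def by (simp only: restrict_apply if_False if_True)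
        then show ?thesis by simp
      qed
    qed (simp add: G_def)
    moreover have "view b X k a = glue G"
    proof (intro set_eqI iffI)
      fix y assume "y \<in> view b X k a"
      then have w: "y \<in> window" and x: "(1 / real b ^ k) *\<^sub>R (y + real_vec a) \<in> X" (is "?x \<in> X")
        by (auto simp: view_def)
      have x01: "0 \<le> ?x $ i \<and> ?x $ i \<le> 1" for i
        using x assms(2) by (auto simp: mem_box_cart subset_iff)
      have bk: "real b ^ k > 0" using assms(1) by simp
      have y0: "0 \<le> y $ i + a $ i" and y1: "y $ i + a $ i \<le> real b ^ k" for i
        using x01[of i] bk by (auto simp: field_simps)
      \<comment> \<open>The minimum matters for points on the upper boundary of the unit cube: their integer
        part is out of range, and the cell below is taken instead.\<close>
      define c where "c = (\<chi> i. min \<lfloor>y $ i + a $ i\<rfloor> (int b ^ k - 1) - a $ i)"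
      have bk1: "int b ^ k \<ge> 1" using assms(1) by simp
      have range: "0 \<le> (a + c) $ i \<and> (a + c) $ i < int b ^ k" for i
      proof -
        have "0 \<le> \<lfloor>y $ i + a $ i\<rfloor>" using y0[of i] by linarith
        moreover have "(a + c) $ i = min \<lfloor>y $ i + a $ i\<rfloor> (int b ^ k - 1)" by (simp add: c_def)
        ultimately show ?thesis using bk1 by linarith
      qed
      have z: "0 \<le> y $ i - c $ i \<and> y $ i - c $ i \<le> 1" for i
      proof -
        have "real_of_int (min \<lfloor>y $ i + a $ i\<rfloor> (int b ^ k - 1)) \<le> y $ i + a $ i"
          by linarith
        moreover have "y $ i + a $ i \<le> real_of_int (min \<lfloor>y $ i + a $ i\<rfloor> (int b ^ k - 1)) + 1"
        proof (cases "\<lfloor>y $ i + a $ i\<rfloor> \<le> int b ^ k - 1")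
          case True
          then show ?thesis by simp
        next
          case False
          then show ?thesis using y1[of i] by (simp add: min_def)
        qed
        ultimately show ?thesis unfolding c_def by simp
      qed
      have "c \<in> cells" unfolding cells_def
      proof (simp, intro allI)
        fix i
        have "\<bar>y $ i\<bar> \<le> 3" using w by (simp add: cube_def)
        then show "- 4 \<le> c $ i \<and> c $ i \<le> 3" using z[of i] by linarith
      qed
      moreover have "y - real_vec c \<in> piece k (a + c)"
      proof -
        have "y - real_vec c = real b ^ k *\<^sub>R ?x - real_vec (a + c)"
          using assms(1) by (simp add: vec_eq_iff)
        moreover have "y - real_vec c \<in> unit_cube" using z by (simp add: mem_box_cart)
        ultimately show ?thesis unfolding piece_def using x by blast
      qed
      moreover from range \<open>c \<in> cells\<close> have "G c = piece k (a + c)" unfolding G_def by simp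
      ultimately show "y \<in> glue G" unfolding glue_def using w
        by (intro UN_I[of c]) (auto intro!: image_eqI[of _ _ "y - real_vec c"])
    next
      fix y assume "y \<in> glue G"
      then obtain c z where c: "c \<in> cells" "y \<in> window" "z \<in> G c" "y = real_vec c + z"
        unfolding glue_def by auto
      then have "z \<in> piece k (a + c)" by (auto simp: G_def split: if_splits)
      then obtain x where x: "x \<in> X" "z = real b ^ k *\<^sub>R x - real_vec (a + c)"
        unfolding piece_def by auto
      have "y + real_vec a = real b ^ k *\<^sub>R x" by (simp add: c(4) x(2) vec_eq_iff)
      then have "(1 / real b ^ k) *\<^sub>R (y + real_vec a) = x" using assms(1) by simp
      then show "y \<in> view b X k a" using c x by (simp add: view_def)
    qed
    ultimately show "view b X k a \<in> glue ` (PiE cells (\<lambda>_. insert {} (b_kernel b X)))" by blast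
  qed
  moreover have "finite (PiE cells (\<lambda>_. insert {} (b_kernel b X)))"
    using fin_cells assms(3) by (intro finite_PiE) (auto simp: b_self_similar_def)
  ultimately show ?thesis unfolding finite_views_def by (rule finite_surj[rotated])
qed

lemma b_self_similar_if_finite_views:
  assumes "b > 0" "finite_views b X"
  shows "b_self_similar b X"
proof -
  have "b_kernel b X \<subseteq> (\<lambda>V. V \<inter> unit_cube) ` {view b X k a | k a. True}"
  proof
    fix K assume "K \<in> b_kernel b X"
    then obtain k a where K: "K = (\<lambda>x. real b ^ k *\<^sub>R x - real_vec a) ` X \<inter> unit_cube"
      unfolding b_kernel_def by blast
    have bk: "real b ^ k > 0" using assms(1) by simp
    have "K = view b X k a \<inter> unit_cube"
    proof (intro set_eqI iffI)
      fix y assume "y \<in> K"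
      then obtain x where x: "x \<in> X" "y = real b ^ k *\<^sub>R x - real_vec a" and y: "y \<in> unit_cube"
        unfolding K by auto
      have "(1 / real b ^ k) *\<^sub>R (y + real_vec a) = x"
        unfolding x using assms(1) by (simp add: vec_eq_iff)
      moreover have "y \<in> window" unfolding cube_def
      proof (intro CollectI allI)
        fix i
        have "0 \<le> y $ i \<and> y $ i \<le> 1" using y by (auto simp: mem_box_cart)
        then show "\<bar>y $ i\<bar> \<le> 3" by linarith
      qed
      ultimately show "y \<in> view b X k a \<inter> unit_cube" using x(1) y by (simp add: view_def)
    next
      fix y assume y: "y \<in> view b X k a \<inter> unit_cube"
      have "y = real b ^ k *\<^sub>R ((1 / real b ^ k) *\<^sub>R (y + real_vec a)) - real_vec a"
        using assms(1) by (simp add: vec_eq_iff)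
      moreover have "(1 / real b ^ k) *\<^sub>R (y + real_vec a) \<in> X" using y by (simp add: view_def)
      ultimately have "y \<in> (\<lambda>x. real b ^ k *\<^sub>R x - real_vec a) ` X" by (rule image_eqI)
      then show "y \<in> K" unfolding K using y by blast
    qed
    then show "K \<in> (\<lambda>V. V \<inter> unit_cube) ` {view b X k a | k a. True}" by blast
  qed
  then show ?thesis using assms(2) unfolding b_self_similar_def finite_views_def
    using finite_surj by blast
qed

section \<open>Rational half-spaces\<close>

definition rational_polyhedron :: "(real ^ 'n) set \<Rightarrow> bool" where
  "rational_polyhedron P \<longleftrightarrow> (\<exists>F. finite F \<and>
     (\<forall>(N, M)\<in>F. rational_point N \<and> M \<in> \<rat>) \<and> P = {x. \<forall>(N, M)\<in>F. N \<bullet> x \<le> M})"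

lemma rational_polyhedron_UNIV [simp]: "rational_polyhedron UNIV"
  unfolding rational_polyhedron_def by (rule exI[of _ "{}"]) simp

lemma rational_polyhedron_halfspace:
  assumes "rational_point N" "M \<in> \<rat>"
  shows "rational_polyhedron {x. N \<bullet> x \<le> M}"
  unfolding rational_polyhedron_def using assms by (intro exI[of _ "{(N, M)}"]) simp

lemma rational_polyhedron_Int:
  assumes "rational_polyhedron P" "rational_polyhedron Q"
  shows "rational_polyhedron (P \<inter> Q)"
proof -
  from assms obtain F G where
    "finite F" "\<forall>(N, M)\<in>F. rational_point N \<and> M \<in> \<rat>" "P = {x. \<forall>(N, M)\<in>F. N \<bullet> x \<le> M}"
    "finite G" "\<forall>(N, M)\<in>G. rational_point N \<and> M \<in> \<rat>" "Q = {x. \<forall>(N, M)\<in>G. N \<bullet> x \<le> M}"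
    unfolding rational_polyhedron_def by blast
  then show ?thesis unfolding rational_polyhedron_def by (intro exI[of _ "F \<union> G"]) auto
qed

lemma rational_polyhedron_INT:
  assumes "finite A" "\<And>c. c \<in> A \<Longrightarrow> rational_polyhedron (P c)"
  shows "rational_polyhedron (\<Inter>c\<in>A. P c)"
  using assms by (induction A) (auto intro: rational_polyhedron_Int)

text \<open>
  After clearing denominators, rescaling and translating by lattice vectors only changes the
  right-hand side of the inequality, and keeps it an integer. In the window the left-hand side is
  bounded by B, so all right-hand sides beyond this bound give the same view.
\<close>
lemma finite_views_halfspace:
  fixes N :: "real ^ 'n"
  assumes "b > 0" "rational_point N" "M \<in> \<rat>"
  shows "finite_views b {x. N \<bullet> x \<le> M}"
proof -
  have "finite (insert M (range (\<lambda>i. N $ i)))" "insert M (range (\<lambda>i. N $ i)) \<subseteq> \<rat>"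
    using assms by (auto simp: rational_point_def)
  from common_denominator[OF this] obtain d :: nat where
    d: "d > 0" "real d * M \<in> \<int>" "\<And>i. real d * N $ i \<in> \<int>" by auto
  define B where "B = \<lceil>\<Sum>i\<in>UNIV. 3 * \<bar>real d * N $ i\<bar>\<rceil>"
  have bound: "\<bar>real d * (N \<bullet> y)\<bar> \<le> B" if "y \<in> window" for y
  proof -
    have "\<bar>real d * (N \<bullet> y)\<bar> = \<bar>\<Sum>i\<in>UNIV. real d * N $ i * y $ i\<bar>"
      by (simp add: inner_vec_def sum_distrib_left mult.assoc)
    also have "\<dots> \<le> (\<Sum>i\<in>UNIV. \<bar>real d * N $ i * y $ i\<bar>)" by (rule sum_abs)
    also have "\<dots> \<le> (\<Sum>i\<in>UNIV. 3 * \<bar>real d * N $ i\<bar>)"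
    proof (rule sum_mono)
      fix i
      have "\<bar>y $ i\<bar> \<le> 3" using that by (simp add: cube_def)
      then have "\<bar>real d * N $ i\<bar> * \<bar>y $ i\<bar> \<le> \<bar>real d * N $ i\<bar> * 3" by (intro mult_left_mono) auto
      then show "\<bar>real d * N $ i * y $ i\<bar> \<le> 3 * \<bar>real d * N $ i\<bar>" by (simp add: abs_mult)
    qed
    finally show ?thesis unfolding B_def by linarith
  qed
  define cut where "cut j = {y \<in> window. real d * (N \<bullet> y) \<le> real_of_int j}" for j :: int
  have "{view b {x. N \<bullet> x \<le> M} k a | k a. True} \<subseteq> cut ` {- B - 1..max B (- B - 1)}"
  proof clarify
    fix k a
    have bk: "real b ^ k > 0" using assms(1) by simp
    have "real d * (N \<bullet> real_vec a) = (\<Sum>i\<in>UNIV. (real d * N $ i) * of_int (a $ i))"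
      by (simp add: inner_vec_def sum_distrib_left mult.assoc)
    also have "\<dots> \<in> \<int>" by (intro Ints_sum Ints_mult d Ints_of_int)
    finally have "real d * (N \<bullet> real_vec a) \<in> \<int>" .
    moreover have "real b ^ k * (real d * M) \<in> \<int>" by (intro Ints_mult Ints_power d Ints_of_nat)
    ultimately have "real b ^ k * (real d * M) - real d * (N \<bullet> real_vec a) \<in> \<int>" by simp
    then obtain j where j: "real b ^ k * (real d * M) - real d * (N \<bullet> real_vec a) = of_int j"
      by (auto elim: Ints_cases)
    define j' where "j' = max (- B - 1) (min j B)"
    have "(1 / real b ^ k) *\<^sub>R (y + real_vec a) \<in> {x. N \<bullet> x \<le> M} \<longleftrightarrow> real d * (N \<bullet> y) \<le> of_int j" for y
    proof -
      have "(1 / real b ^ k) *\<^sub>R (y + real_vec a) \<in> {x. N \<bullet> x \<le> M} \<longleftrightarrow>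
          N \<bullet> y + N \<bullet> real_vec a \<le> real b ^ k * M"
        using bk by (simp add: inner_simps field_simps)
      also have "\<dots> \<longleftrightarrow> real d * (N \<bullet> y + N \<bullet> real_vec a) \<le> real d * (real b ^ k * M)"
        using d(1) by simp
      also have "\<dots> \<longleftrightarrow> real d * (N \<bullet> y) \<le> of_int j"
        unfolding j[symmetric] by (auto simp: algebra_simps)
      finally show ?thesis .
    qed
    moreover have "real d * (N \<bullet> y) \<le> of_int j \<longleftrightarrow> real d * (N \<bullet> y) \<le> of_int j'"
      if "y \<in> window" for y
      using bound[OF that] unfolding j'_def by linarith
    ultimately have "view b {x. N \<bullet> x \<le> M} k a = cut j'"
      unfolding view_def cut_def by blast
    moreover have "j' \<in> {- B - 1..max B (- B - 1)}" by (auto simp: j'_def)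
    ultimately show "view b {x. N \<bullet> x \<le> M} k a \<in> cut ` {- B - 1..max B (- B - 1)}" by blast
  qed
  then show ?thesis unfolding finite_views_def by (meson finite_atLeastAtMost_int finite_surj)
qed

lemma finite_views_rational_polyhedron:
  assumes "b > 0" "rational_polyhedron P"
  shows "finite_views b P"
proof -
  from assms(2) obtain F where F: "finite F" "\<forall>(N, M)\<in>F. rational_point N \<and> M \<in> \<rat>"
    "P = {x. \<forall>(N, M)\<in>F. N \<bullet> x \<le> M}" unfolding rational_polyhedron_def by blast
  from F(1,2) have "finite_views b {x. \<forall>(N, M)\<in>F. N \<bullet> x \<le> M}"
  proof (induction F)
    case empty
    then show ?case by simp
  next
    case (insert f F)
    obtain N M where f: "f = (N, M)" by force
    have "{x. \<forall>(N, M)\<in>insert f F. N \<bullet> x \<le> M} = {x. N \<bullet> x \<le> M} \<inter> {x. \<forall>(N, M)\<in>F. N \<bullet> x \<le> M}"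
      unfolding f by auto
    moreover have "finite_views b {x. N \<bullet> x \<le> M}"
      using insert.prems assms(1) unfolding f by (intro finite_views_halfspace) auto
    ultimately show ?case using insert by (auto intro: finite_views_Int)
  qed
  then show ?thesis using F by simp
qed


section \<open>Rational polytopes are rational polyhedra\<close>

text \<open>
  Constraints with positive e bound s from below and those with negative e bound it from above;
  s exists when no lower bound exceeds an upper bound. Cleared of denominators, these comparisons
  stay affine in p, so that eliminating s from a rational system leaves a rational system.
\<close>
lemma Fourier_Motzkin_one_variable:
  fixes p e :: "'a \<Rightarrow> real"
  assumes "finite C"
    and lower: "\<exists>c\<in>C. e c > 0" and upper: "\<exists>c\<in>C. e c < 0"
  shows "(\<exists>s. \<forall>c\<in>C. p c \<le> s * e c) \<longleftrightarrow>
    (\<forall>c\<in>C. e c = 0 \<longrightarrow> p c \<le> 0) \<and>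
    (\<forall>c\<in>C. \<forall>c'\<in>C. e c > 0 \<and> e c' < 0 \<longrightarrow> p c' * e c - p c * e c' \<le> 0)"
proof
  assume "\<exists>s. \<forall>c\<in>C. p c \<le> s * e c"
  then obtain s where s: "\<And>c. c \<in> C \<Longrightarrow> p c \<le> s * e c" by blast
  have "p c' * e c - p c * e c' \<le> 0" if "c \<in> C" "c' \<in> C" "e c > 0" "e c' < 0" for c c'
  proof -
    have "p c' * e c \<le> (s * e c') * e c" using s[OF that(2)] that(3) by (intro mult_right_mono) auto
    moreover have "(s * e c) * e c' \<le> p c * e c'"
      using s[OF that(1)] that(4) by (intro mult_right_mono_neg) auto
    ultimately show ?thesis by (simp add: mult_ac)
  qed
  moreover have "p c \<le> 0" if "c \<in> C" "e c = 0" for c using s[OF that(1)] that(2) by simp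
  ultimately show "(\<forall>c\<in>C. e c = 0 \<longrightarrow> p c \<le> 0) \<and>
    (\<forall>c\<in>C. \<forall>c'\<in>C. e c > 0 \<and> e c' < 0 \<longrightarrow> p c' * e c - p c * e c' \<le> 0)" by blast
next
  assume *: "(\<forall>c\<in>C. e c = 0 \<longrightarrow> p c \<le> 0) \<and>
    (\<forall>c\<in>C. \<forall>c'\<in>C. e c > 0 \<and> e c' < 0 \<longrightarrow> p c' * e c - p c * e c' \<le> 0)"
  define L where "L = (\<lambda>c. p c / e c) ` {c \<in> C. e c > 0}"
  have L: "finite L" "L \<noteq> {}" unfolding L_def using assms by auto
  have "Max L \<in> L" using L by (rule Max_in)
  then obtain c0 where c0: "c0 \<in> C" "e c0 > 0" "Max L = p c0 / e c0" unfolding L_def by blast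
  have "p c \<le> Max L * e c" if "c \<in> C" for c
  proof (cases "e c" "0 :: real" rule: linorder_cases)
    case less
    then have "p c * e c0 - p c0 * e c \<le> 0" using * c0 that by blast
    then show ?thesis unfolding c0(3) using c0(2) by (simp add: field_simps)
  next
    case equal
    then show ?thesis using * that by simp
  next
    case greater
    then have "p c / e c \<le> Max L" using that by (intro Max_ge L) (auto simp: L_def)
    then show ?thesis using greater by (simp add: field_simps)
  qed
  then show "\<exists>s. \<forall>c\<in>C. p c \<le> s * e c" by blast
qed

lemma rational_point_diff: "rational_point u \<Longrightarrow> rational_point v \<Longrightarrow> rational_point (u - v)"
  by (simp add: rational_point_def)

lemma rational_point_scaleR: "t \<in> \<rat> \<Longrightarrow> rational_point v \<Longrightarrow> rational_point (t *\<^sub>R v)"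
  by (simp add: rational_point_def)

lemma rational_point_inner: "rational_point u \<Longrightarrow> rational_point v \<Longrightarrow> u \<bullet> v \<in> \<rat>"
  by (auto simp: rational_point_def inner_vec_def intro!: Rats_sum)

lemma bounded_polyhedron_no_recession:
  fixes y :: "real ^ 'n"
  assumes "bounded P" "p \<in> P" "P = {x. \<forall>(N, M)\<in>F. N \<bullet> x \<le> M}"
    and "\<forall>(N, M)\<in>F. N \<bullet> y \<le> 0"
  shows "y = 0"
proof (rule ccontr)
  assume "y \<noteq> 0"
  obtain B where B: "\<And>x. x \<in> P \<Longrightarrow> norm x \<le> B" using assms(1) by (auto simp: bounded_iff)
  define t where "t = (B + norm p + 1) / norm y"
  have "B \<ge> 0" using B[OF assms(2)] norm_ge_zero order_trans by blast
  then have t: "t \<ge> 0" unfolding t_def by simp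
  have "p + t *\<^sub>R y \<in> P"
    unfolding assms(3)
  proof clarify
    fix N M assume "(N, M) \<in> F"
    then have "N \<bullet> p \<le> M" "N \<bullet> y \<le> 0" using assms(2-4) by auto
    moreover from this t have "t * (N \<bullet> y) \<le> 0" by (simp add: mult_nonneg_nonpos)
    ultimately show "N \<bullet> (p + t *\<^sub>R y) \<le> M" by (simp add: inner_simps)
  qed
  then have "norm (p + t *\<^sub>R y) \<le> B" by (rule B)
  moreover have "norm (t *\<^sub>R y) \<le> norm (p + t *\<^sub>R y) + norm p"
    using norm_triangle_ineq4[of "p + t *\<^sub>R y" p] by simp
  moreover have "norm (t *\<^sub>R y) = B + norm p + 1"
    using \<open>y \<noteq> 0\<close> \<open>B \<ge> 0\<close> unfolding t_def by simp
  ultimately show False by simp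
qed

lemma rational_polyhedron_singleton:
  fixes v :: "real ^ 'n"
  assumes "rational_point v"
  shows "rational_polyhedron {v}"
proof -
  have rat: "rational_point (axis i 1 :: real ^ 'n)" "rational_point (- axis i 1 :: real ^ 'n)" for i
    by (auto simp: rational_point_def axis_def)
  have "{v} = (\<Inter>i\<in>UNIV. {x. axis i 1 \<bullet> x \<le> v $ i} \<inter> {x. (- axis i 1) \<bullet> x \<le> - (v $ i)})"
    by (auto simp: inner_axis' vec_eq_iff order.eq_iff[of "_ :: real"])
  also have "rational_polyhedron \<dots>" using assms rat
    by (intro rational_polyhedron_INT rational_polyhedron_Int rational_polyhedron_halfspace)
      (auto simp: rational_point_def)
  finally show ?thesis .
qed

text \<open>
  Vertices are added one at a time. A point x of the hull of v and P is \<open>(1 - s) v + s p\<close> with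
  p in P, and the inequalities for p become inequalities affine in x and s, from which s is
  eliminated. The case \<open>s = 0\<close> would admit recession directions of P, but P is bounded.
\<close>
lemma rational_polyhedron_convex_hull:
  fixes S :: "(real ^ 'n) set"
  assumes "finite S" "\<forall>v\<in>S. rational_point v"
  shows "rational_polyhedron (convex hull S)"
  using assms
proof (induction S)
  case empty
  have "{x :: real ^ 'n. 0 \<bullet> x \<le> -1} = {}" by simp
  moreover have "rational_polyhedron {x :: real ^ 'n. 0 \<bullet> x \<le> -1}"
    by (intro rational_polyhedron_halfspace) (auto simp: rational_point_def)
  ultimately show ?case by simp
next
  case (insert v S)
  show ?case
  proof (cases "S = {}")
    case True
    then show ?thesis using insert.prems by (simp add: rational_polyhedron_singleton)
  next
    case False
    define P where "P = convex hull S"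
    from insert have "rational_polyhedron P" by (simp add: P_def)
    then obtain F where F: "finite F" "\<forall>(N, M)\<in>F. rational_point N \<and> M \<in> \<rat>"
      and P: "P = {x. \<forall>(N, M)\<in>F. N \<bullet> x \<le> M}"
      unfolding rational_polyhedron_def by blast
    obtain p0 where p0: "p0 \<in> P" using False unfolding P_def by (metis convex_hull_eq_empty ex_in_conv)
    have bounded: "bounded P" unfolding P_def using insert.hyps(1)
      by (intro bounded_convex_hull finite_imp_bounded)
    have v: "rational_point v" using insert.prems by simp
    \<comment> \<open>A triple (N, d, e) stands for the constraint \<open>N \<bullet> x - d \<le> s * e\<close>; the first two are
      \<open>0 \<le> s\<close> and \<open>s \<le> 1\<close>.\<close>
    define C where "C = insert (0, 0, 1) (insert (0, 1, -1)
        ((\<lambda>(N, M). (N, N \<bullet> v, M - N \<bullet> v)) ` F))"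
    have "finite C" using F(1) by (simp add: C_def)
    have C_rat: "rational_point (fst c) \<and> fst (snd c) \<in> \<rat> \<and> snd (snd c) \<in> \<rat>" if "c \<in> C" for c
    proof -
      have "rational_point (0 :: real ^ 'n)" by (simp add: rational_point_def)
      moreover have "rational_point N \<and> N \<bullet> v \<in> \<rat> \<and> M - N \<bullet> v \<in> \<rat>" if "(N, M) \<in> F" for N M
        using F(2) that rational_point_inner[OF _ v] by (auto intro!: Rats_diff)
      ultimately show ?thesis using that by (auto simp: C_def)
    qed
    have "x \<in> convex hull (insert v S) \<longleftrightarrow>
        (\<exists>s. \<forall>c\<in>C. fst c \<bullet> x - fst (snd c) \<le> s * snd (snd c))" for x
    proof
      assume "x \<in> convex hull (insert v S)"
      then obtain p where p: "p \<in> P" "x \<in> closed_segment v p"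
        using False by (auto simp: convex_hull_insert_segments P_def)
      then obtain s where s: "0 \<le> s" "s \<le> 1" "x = (1 - s) *\<^sub>R v + s *\<^sub>R p"
        by (auto simp: in_segment)
      have "N \<bullet> x - N \<bullet> v \<le> s * (M - N \<bullet> v)" if "(N, M) \<in> F" for N M
      proof -
        have "N \<bullet> p \<le> M" using p(1) that by (auto simp: P)
        then have "s * (N \<bullet> p) \<le> s * M" using s(1) by (rule mult_left_mono)
        then show ?thesis unfolding s(3) by (simp add: inner_simps algebra_simps)
      qed
      then have "\<forall>c\<in>C. fst c \<bullet> x - fst (snd c) \<le> s * snd (snd c)"
        using s(1,2) by (auto simp: C_def)
      then show "\<exists>s. \<forall>c\<in>C. fst c \<bullet> x - fst (snd c) \<le> s * snd (snd c)" ..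
    next
      assume "\<exists>s. \<forall>c\<in>C. fst c \<bullet> x - fst (snd c) \<le> s * snd (snd c)"
      then obtain s where s: "\<And>c. c \<in> C \<Longrightarrow> fst c \<bullet> x - fst (snd c) \<le> s * snd (snd c)" by blast
      have s01: "0 \<le> s" "s \<le> 1"
        using s[of "(0, 0, 1)"] s[of "(0, 1, -1)"] by (auto simp: C_def)
      have sF: "N \<bullet> x - N \<bullet> v \<le> s * (M - N \<bullet> v)" if "(N, M) \<in> F" for N M
        using s[of "(N, N \<bullet> v, M - N \<bullet> v)"] that by (force simp: C_def)
      have "\<exists>p\<in>P. x \<in> closed_segment v p"
      proof (cases "s = 0")
        case True
        have "\<forall>(N, M)\<in>F. N \<bullet> (x - v) \<le> 0" using sF True by (auto simp: inner_simps)
        from bounded_polyhedron_no_recession[OF bounded p0 P this] have "x = v" by simp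
        then show ?thesis using p0 by auto
      next
        case False
        then have "s > 0" using s01 by simp
        define p where "p = v + (1 / s) *\<^sub>R (x - v)"
        have "N \<bullet> p \<le> M" if "(N, M) \<in> F" for N M
        proof -
          have "s * (N \<bullet> p) = s * (N \<bullet> v) + (N \<bullet> x - N \<bullet> v)"
            using \<open>s > 0\<close> by (simp add: p_def inner_simps distrib_left)
          also have "\<dots> \<le> s * M" using sF[OF that] by (simp add: algebra_simps)
          finally show ?thesis using \<open>s > 0\<close> by simp
        qed
        then have "p \<in> P" by (auto simp: P)
        moreover have "x = (1 - s) *\<^sub>R v + s *\<^sub>R p"
          unfolding p_def using \<open>s > 0\<close> by (simp add: algebra_simps)
        ultimately show ?thesis using s01 unfolding in_segment by blast
      qed
      then show "x \<in> convex hull (insert v S)"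
        using False by (auto simp: convex_hull_insert_segments P_def)
    qed
    moreover have "\<exists>c\<in>C. snd (snd c) > 0" "\<exists>c\<in>C. snd (snd c) < 0" by (auto simp: C_def)
    ultimately have mem: "x \<in> convex hull (insert v S) \<longleftrightarrow>
        (\<forall>c\<in>C. snd (snd c) = 0 \<longrightarrow> fst c \<bullet> x - fst (snd c) \<le> 0) \<and>
        (\<forall>c\<in>C. \<forall>c'\<in>C. snd (snd c) > 0 \<and> snd (snd c') < 0 \<longrightarrow>
          (fst c' \<bullet> x - fst (snd c')) * snd (snd c) - (fst c \<bullet> x - fst (snd c)) * snd (snd c') \<le> 0)" for x
      using Fourier_Motzkin_one_variable[OF \<open>finite C\<close>, of "\<lambda>c. snd (snd c)"
          "\<lambda>c. fst c \<bullet> x - fst (snd c)"] by simp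
    have eq: "convex hull (insert v S) =
        (\<Inter>c\<in>C. {x. snd (snd c) = 0 \<longrightarrow> fst c \<bullet> x \<le> fst (snd c)}) \<inter>
        (\<Inter>c\<in>C. \<Inter>c'\<in>C. {x. snd (snd c) > 0 \<and> snd (snd c') < 0 \<longrightarrow>
          (snd (snd c) *\<^sub>R fst c' - snd (snd c') *\<^sub>R fst c) \<bullet> x \<le>
          snd (snd c) * fst (snd c') - snd (snd c') * fst (snd c)})"
      by (intro set_eqI) (simp add: mem inner_simps algebra_simps)
    have imp: "rational_polyhedron {x. Q \<longrightarrow> N \<bullet> x \<le> M}"
      if "rational_point N" "M \<in> \<rat>" for Q :: bool and N :: "real ^ 'n" and M
      using rational_polyhedron_halfspace[OF that] by (cases Q) auto
    show ?thesis unfolding eq using \<open>finite C\<close> C_rat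
      by (intro rational_polyhedron_Int rational_polyhedron_INT imp rational_point_diff
          rational_point_scaleR
          Rats_diff Rats_mult) auto
  qed
qed

lemma finite_views_rational_polytope:
  assumes "b > 0" "rational_polytope P"
  shows "finite_views b P"
  using assms rational_polyhedron_convex_hull finite_views_rational_polyhedron
  unfolding rational_polytope_iff by blast


section \<open>Conical points\<close>

definition conical_at :: "real ^ 'n \<Rightarrow> real \<Rightarrow> (real ^ 'n) set \<Rightarrow> bool" where
  "conical_at q r X \<longleftrightarrow>
    (\<forall>y\<in>cube r. \<forall>s. 0 < s \<and> s \<le> 1 \<longrightarrow> (q + y \<in> X \<longleftrightarrow> q + s *\<^sub>R y \<in> X))"

lemma scale_cube: "y \<in> cube r \<Longrightarrow> \<bar>s\<bar> * r \<le> r' \<Longrightarrow> s *\<^sub>R y \<in> cube r'"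
  unfolding cube_def
  by (auto simp: abs_mult intro: order_trans[OF mult_left_mono])

lemma power_bracket:
  fixes \<theta> s :: real
  assumes "0 < \<theta>" "\<theta> < 1" "0 < s" "s \<le> 1"
  obtains m where "\<theta> ^ Suc m < s" "s \<le> \<theta> ^ m"
proof -
  define n where "n = (LEAST n. \<theta> ^ n < s)"
  have "\<exists>n. \<theta> ^ n < s" using real_arch_pow_inv assms by blast
  then have n: "\<theta> ^ n < s" unfolding n_def by (rule LeastI_ex)
  then have "n \<noteq> 0" using assms by (intro notI) simp
  then obtain m where m: "n = Suc m" using not0_implies_Suc by blast
  then have "\<not> \<theta> ^ m < s" using not_less_Least[of m "\<lambda>n. \<theta> ^ n < s"] by (simp add: n_def)
  then show ?thesis using that[of m] n m by simp
qed

text \<open>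
  The powers of a ratio close to 1 form a fine net in the unit interval, so closedness extends the
  invariance to all ratios. The two implications use the net differently: downwards, s is the
  limit of powers of the ratios; upwards, 1 is the limit of quotients of s by such powers.
\<close>
lemma scaling_invariance_closure:
  fixes Y :: "(real ^ 'n) set"
  assumes "closed Y"
    and ratios: "\<And>\<epsilon>. \<epsilon> > 0 \<Longrightarrow> \<exists>\<theta>. 1 - \<epsilon> < \<theta> \<and> 0 < \<theta> \<and> \<theta> < 1 \<and>
      (\<forall>w\<in>cube \<rho>. w \<in> Y \<longleftrightarrow> \<theta> *\<^sub>R w \<in> Y)"
    and w: "w \<in> cube \<rho>" and s: "0 < s" "s \<le> 1"
  shows "w \<in> Y \<longleftrightarrow> s *\<^sub>R w \<in> Y"
proof -
  define T where "T = {t :: real. t *\<^sub>R w \<in> Y}"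
  have "closed T"
    using continuous_closed_vimage[OF \<open>closed Y\<close>, of "\<lambda>t :: real. t *\<^sub>R w"]
    by (simp add: T_def vimage_def)
  have near: "\<exists>\<theta> m. 1 - \<epsilon> < \<theta> \<and> 0 < \<theta> \<and> \<theta> < 1 \<and> \<theta> ^ Suc m < s \<and> s \<le> \<theta> ^ m \<and>
      (\<forall>t. 0 \<le> t \<and> t \<le> 1 \<longrightarrow> (t \<in> T \<longleftrightarrow> \<theta> ^ m * t \<in> T))" if "\<epsilon> > 0" for \<epsilon>
  proof -
    from ratios[OF that] obtain \<theta> where \<theta>: "1 - \<epsilon> < \<theta>" "0 < \<theta>" "\<theta> < 1"
      and inv: "\<And>w. w \<in> cube \<rho> \<Longrightarrow> w \<in> Y \<longleftrightarrow> \<theta> *\<^sub>R w \<in> Y" by blast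
    have "t \<in> T \<longleftrightarrow> \<theta> ^ m * t \<in> T" if "0 \<le> t" "t \<le> 1" for t m
    proof (induction m)
      case (Suc m)
      have "\<theta> ^ m * t \<le> 1" using that \<theta> by (intro mult_le_one power_le_one) auto
      moreover have "0 \<le> \<theta> ^ m * t" using that \<theta> by simp
      moreover have "0 \<le> \<rho>" using w by (auto simp: cube_def intro: order_trans[OF abs_ge_zero])
      ultimately have "(\<theta> ^ m * t) *\<^sub>R w \<in> cube \<rho>"
        by (intro scale_cube[OF w]) (simp add: mult_left_le_one_le)
      from inv[OF this] Suc show ?case by (simp add: T_def mult.assoc)
    qed simp
    moreover obtain m where "\<theta> ^ Suc m < s" "s \<le> \<theta> ^ m"
      using power_bracket \<theta> s by blast
    ultimately show ?thesis using \<theta> by blast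
  qed
  have "1 \<in> T \<longleftrightarrow> s \<in> T"
  proof
    assume "1 \<in> T"
    have "\<exists>t\<in>T. dist t s < \<epsilon>" if "\<epsilon> > 0" for \<epsilon>
    proof -
      from near[OF that] obtain \<theta> m where \<theta>: "1 - \<epsilon> < \<theta>" "0 < \<theta>" "\<theta> < 1" "\<theta> ^ Suc m < s" "s \<le> \<theta> ^ m"
        and inv: "\<And>t. 0 \<le> t \<Longrightarrow> t \<le> 1 \<Longrightarrow> t \<in> T \<longleftrightarrow> \<theta> ^ m * t \<in> T" by blast
      from inv[of 1] \<open>1 \<in> T\<close> have "\<theta> ^ m \<in> T" by simp
      moreover have "\<theta> ^ m * (1 - \<theta>) \<le> 1 - \<theta>"
        using \<theta> by (intro mult_left_le_one_le) (auto intro: power_le_one)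
      then have "dist (\<theta> ^ m) s < \<epsilon>" using \<theta> by (simp add: dist_real_def algebra_simps)
      ultimately show ?thesis by blast
    qed
    then show "s \<in> T" using \<open>closed T\<close> closed_approachable by blast
  next
    assume "s \<in> T"
    have "\<exists>t\<in>T. dist t 1 < \<epsilon>" if "\<epsilon> > 0" for \<epsilon>
    proof -
      from near[OF that] obtain \<theta> m where \<theta>: "1 - \<epsilon> < \<theta>" "0 < \<theta>" "\<theta> < 1" "\<theta> ^ Suc m < s" "s \<le> \<theta> ^ m"
        and inv: "\<And>t. 0 \<le> t \<Longrightarrow> t \<le> 1 \<Longrightarrow> t \<in> T \<longleftrightarrow> \<theta> ^ m * t \<in> T" by blast
      define t where "t = s / \<theta> ^ m"
      have "\<theta> ^ m > 0" using \<theta> by simp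
      then have "0 \<le> t" "t \<le> 1" "\<theta> < t" "\<theta> ^ m * t = s"
        using \<theta> s by (auto simp: t_def field_simps)
      moreover from this have "t \<in> T" using inv[of t] \<open>s \<in> T\<close> by simp
      moreover have "dist t 1 < \<epsilon>" using \<open>\<theta> < t\<close> \<open>t \<le> 1\<close> \<theta> by (simp add: dist_real_def)
      ultimately show ?thesis by blast
    qed
    then show "1 \<in> T" using \<open>closed T\<close> closed_approachable by blast
  qed
  then show ?thesis by (simp add: T_def)
qed

lemma infinite_bounded_reals_close:
  fixes T :: "real set"
  assumes "infinite T" "T \<subseteq> {A..B}" "\<epsilon> > 0"
  obtains x y where "x \<in> T" "y \<in> T" "x < y" "y - x < \<epsilon>"
proof -
  have "(\<lambda>x. \<lfloor>x / \<epsilon>\<rfloor>) ` T \<subseteq> {\<lfloor>A / \<epsilon>\<rfloor>..\<lfloor>B / \<epsilon>\<rfloor>}"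
    using assms(2,3) by (force intro!: floor_mono divide_right_mono)
  then have "finite ((\<lambda>x. \<lfloor>x / \<epsilon>\<rfloor>) ` T)" using finite_subset by blast
  from pigeonhole_infinite[OF assms(1) this] obtain x where
    x: "x \<in> T" "infinite {y \<in> T. \<lfloor>y / \<epsilon>\<rfloor> = \<lfloor>x / \<epsilon>\<rfloor>}" by blast
  then have "\<not> {y \<in> T. \<lfloor>y / \<epsilon>\<rfloor> = \<lfloor>x / \<epsilon>\<rfloor>} \<subseteq> {x}" using finite_subset by blast
  then obtain y where y: "y \<in> T" "\<lfloor>y / \<epsilon>\<rfloor> = \<lfloor>x / \<epsilon>\<rfloor>" "y \<noteq> x" by blast
  have "\<bar>y / \<epsilon> - x / \<epsilon>\<bar> < 1" using y(2) by linarith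
  then have "\<bar>y - x\<bar> < \<epsilon>" using assms(3) by (simp add: diff_divide_distrib[symmetric] abs_divide)
  then show ?thesis using that[of x y] that[of y x] x(1) y by linarith
qed

section \<open>Cones at rational points\<close>

definition anchor :: "nat \<Rightarrow> real ^ 'n \<Rightarrow> nat \<Rightarrow> int ^ 'n" where
  "anchor b x k = (\<chi> i. \<lfloor>real b ^ k * x $ i\<rfloor>)"

definition offset :: "nat \<Rightarrow> real ^ 'n \<Rightarrow> nat \<Rightarrow> real ^ 'n" where
  "offset b x k = real b ^ k *\<^sub>R x - real_vec (anchor b x k)"

lemma offset_bounds: "0 \<le> offset b x k $ i" "offset b x k $ i < 1"
  unfolding offset_def anchor_def by (simp_all, linarith+)

lemma equal_viewsD:
  assumes "view b X k a = view b X l c" "y \<in> window"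
  shows "(1 / real b ^ k) *\<^sub>R (y + real_vec a) \<in> X \<longleftrightarrow> (1 / real b ^ l) *\<^sub>R (y + real_vec c) \<in> X"
  using assms unfolding view_def by blast

lemma finite_offsets:
  fixes q :: "real ^ 'n"
  assumes "rational_point q"
  shows "finite (range (offset b q))"
proof -
  have "finite (range (\<lambda>i. q $ i))" "range (\<lambda>i. q $ i) \<subseteq> \<rat>"
    using assms by (auto simp: rational_point_def)
  from common_denominator[OF this] obtain d :: nat where
    d: "d > 0" "\<And>i. real d * q $ i \<in> \<int>" by auto
  have "range (offset b q) \<subseteq> {u. \<forall>i. u $ i \<in> (\<lambda>m. of_int m / real d) ` {0..int d}}"
  proof clarify
    fix k i
    have "real b ^ k * (real d * q $ i) - real d * of_int (anchor b q k $ i) \<in> \<int>"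
      by (intro Ints_diff Ints_mult Ints_power Ints_of_nat Ints_of_int d)
    moreover have "real b ^ k * (real d * q $ i) - real d * of_int (anchor b q k $ i) =
        real d * offset b q k $ i" by (simp add: offset_def algebra_simps)
    ultimately have "real d * offset b q k $ i \<in> \<int>" by (simp only:)
    then obtain m where m: "real d * offset b q k $ i = of_int m" by (auto elim: Ints_cases)
    have "0 \<le> real d * offset b q k $ i" "real d * offset b q k $ i \<le> real d * 1"
      using offset_bounds[of b q k i] by (auto intro!: mult_left_mono simp del: mult_1_right)
    then have "m \<in> {0..int d}" unfolding m by auto
    moreover have "offset b q k $ i = of_int m / real d" using m d(1) by (simp add: field_simps)
    ultimately show "offset b q k $ i \<in> (\<lambda>m. of_int m / real d) ` {0..int d}" by blast
  qed
  moreover have "finite {u :: real ^ 'n. \<forall>i. u $ i \<in> (\<lambda>m. of_int m / real d) ` {0..int d}}"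
    by (rule finite_vectors) simp
  ultimately show ?thesis by (rule finite_subset)
qed

lemma finite_view_range:
  assumes "finite_views b X"
  shows "finite (range (\<lambda>k. view b X k (anchor b x k)))"
  using assms unfolding finite_views_def by (rule rev_finite_subset) blast

lemma power_ratios_distinct:
  assumes "mult_independent (real b) (real b')"
    and eq: "real b ^ k / real b' ^ m = real b ^ l / real b' ^ n"
  shows "k = l"
proof (rule ccontr)
  assume "k \<noteq> l"
  from assms(1) have gt: "real b > 1" "real b' > 1" and irr: "ln (real b) / ln (real b') \<notin> \<rat>"
    by (auto simp: mult_independent_def)
  have "ln (real b ^ k / real b' ^ m) = ln (real b ^ l / real b' ^ n)" using eq by simp
  then have "real k * ln (real b) - real m * ln (real b') = real l * ln (real b) - real n * ln (real b')"
    using gt by (simp add: ln_div ln_realpow)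
  then have "(real k - real l) * ln (real b) = (real m - real n) * ln (real b')"
    by (simp add: algebra_simps)
  moreover have "ln (real b') > 0" using gt by simp
  ultimately have "ln (real b) / ln (real b') = (real m - real n) / (real k - real l)"
    using \<open>k \<noteq> l\<close> by (simp add: field_simps)
  then show False using irr by simp
qed

text \<open>
  This is the only place where the two bases interact.
\<close>
lemma rational_point_conical:
  fixes X :: "(real ^ 'n) set"
  assumes b: "b > 1" and b': "b' > 1" and indep: "mult_independent (real b) (real b')"
    and "closed X" and views: "finite_views b X" "finite_views b' X"
    and q: "rational_point q"
  shows "\<exists>r>0. conical_at q r X"
proof -
  define state where "state b k = (view b X k (anchor b q k), offset b q k)" for b k
  have fin_state: "finite (range (state b))" if "finite_views b X" for b
  proof -
    have "range (state b) \<subseteq> range (\<lambda>k. view b X k (anchor b q k)) \<times> range (offset b q)"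
      by (auto simp: state_def)
    then show ?thesis using finite_view_range[OF that] finite_offsets[OF q]
      by (meson finite_SigmaI finite_subset)
  qed
  have same: "q + (1 / real b ^ k) *\<^sub>R z \<in> X \<longleftrightarrow> q + (1 / real b ^ l) *\<^sub>R z \<in> X"
    if "b > 0" "state b k = state b l" "z \<in> cube 1" for b k l z
  proof -
    have pos: "(1 / real b ^ k) *\<^sub>R ((offset b q k + z) + real_vec (anchor b q k)) =
        q + (1 / real b ^ k) *\<^sub>R z" for k
      using that(1) by (simp add: offset_def algebra_simps)
    have "offset b q k + z \<in> window" unfolding cube_def
    proof clarify
      fix i
      have "\<bar>z $ i\<bar> \<le> 1" using that(3) by (simp add: cube_def)
      then show "\<bar>(offset b q k + z) $ i\<bar> \<le> 3" using offset_bounds[of b q k i] by simp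
    qed
    with that(2) have "(1 / real b ^ k) *\<^sub>R ((offset b q k + z) + real_vec (anchor b q k)) \<in> X \<longleftrightarrow>
        (1 / real b ^ l) *\<^sub>R ((offset b q k + z) + real_vec (anchor b q l)) \<in> X"
      by (intro equal_viewsD) (auto simp: state_def)
    moreover have "offset b q k = offset b q l" using that(2) by (simp add: state_def)
    ultimately show ?thesis using pos[of k] pos[of l] by simp
  qed
  have "\<exists>m. b' ^ m \<le> b ^ k \<and> b ^ k < b' ^ (m + 1)" for k
    using b b' by (intro ex_power_ivl1) auto
  then obtain \<kappa> where \<kappa>: "\<And>k. b' ^ \<kappa> k \<le> b ^ k" "\<And>k. b ^ k < b' ^ (\<kappa> k + 1)" by metis
  define both where "both k = (state b k, state b' (\<kappa> k))" for k
  have "range both \<subseteq> range (state b) \<times> range (state b')" by (auto simp: both_def)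
  then have "finite (range both)"
    using fin_state views by (meson finite_SigmaI finite_subset)
  from pigeonhole_infinite[OF infinite_UNIV_nat this] obtain k0 where
    "infinite {k. both k = both k0}" by auto
  define K where "K = {k. both k = both k0}"
  have K: "infinite K" "\<And>k. k \<in> K \<Longrightarrow> state b k = state b k0 \<and> state b' (\<kappa> k) = state b' (\<kappa> k0)"
    using \<open>infinite {k. both k = both k0}\<close> by (auto simp: K_def both_def)
  define \<tau> where "\<tau> k = real b ^ k / real b' ^ \<kappa> k" for k
  have \<tau>: "1 \<le> \<tau> k" "\<tau> k \<le> real b'" for k
  proof -
    have "real b' ^ \<kappa> k \<le> real b ^ k" using \<kappa>(1)[of k] by (metis of_nat_le_iff of_nat_power)
    moreover have "real b ^ k \<le> real b' * real b' ^ \<kappa> k"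
      using \<kappa>(2)[of k] by (metis Suc_eq_plus1 less_imp_le of_nat_le_iff of_nat_power power_Suc)
    ultimately show "1 \<le> \<tau> k" "\<tau> k \<le> real b'" using b' by (simp_all add: \<tau>_def field_simps)
  qed
  have "inj \<tau>" unfolding \<tau>_def by (rule injI) (rule power_ratios_distinct[OF indep])
  define c where "c = real b' ^ \<kappa> k0"
  have c: "c > 0" using b' by (simp add: c_def)
  \<comment> \<open>Y is X magnified around q at the scale of b' for k0. The equality of the pictures in base b'
    moves from k0 to k, the one in base b moves back from k to k0, and the two scales differ by
    the factor \<open>\<tau> k\<close>; so near 0 the set Y scaled by \<open>\<tau> k\<close> does not depend on k.\<close>
  define Y where "Y = {w. q + (1 / c) *\<^sub>R w \<in> X}"
  have "closed Y"
    using continuous_closed_vimage[OF \<open>closed X\<close>, of "\<lambda>w. q + (1 / c) *\<^sub>R w"]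
    by (simp add: Y_def vimage_def)
  define \<rho> where "\<rho> = 1 / real b'"
  have \<rho>: "0 < \<rho>" "\<rho> \<le> 1" using b' by (auto simp: \<rho>_def)
  have transfer: "w \<in> Y \<longleftrightarrow> q + (1 / real b ^ k0) *\<^sub>R (\<tau> k *\<^sub>R w) \<in> X"
    if "k \<in> K" "w \<in> cube \<rho>" for k w
  proof -
    have "w \<in> cube 1" using scale_cube[OF that(2), of 1 1] \<rho> by simp
    then have "w \<in> Y \<longleftrightarrow> q + (1 / real b' ^ \<kappa> k) *\<^sub>R w \<in> X"
      unfolding Y_def c_def using same[of b' "\<kappa> k0" "\<kappa> k" w] K(2)[OF that(1)] b' by simp
    also have "(1 / real b' ^ \<kappa> k) *\<^sub>R w = (1 / real b ^ k) *\<^sub>R (\<tau> k *\<^sub>R w)"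
      using b by (simp add: \<tau>_def)
    also have "q + \<dots> \<in> X \<longleftrightarrow> q + (1 / real b ^ k0) *\<^sub>R (\<tau> k *\<^sub>R w) \<in> X"
    proof (rule same)
      show "\<tau> k *\<^sub>R w \<in> cube 1"
        using \<tau>[of k] b' by (intro scale_cube[OF that(2)]) (simp add: \<rho>_def)
    qed (use b K(2)[OF that(1)] in auto)
    finally show ?thesis .
  qed
  have ratios: "\<exists>\<theta>. 1 - \<epsilon> < \<theta> \<and> 0 < \<theta> \<and> \<theta> < 1 \<and> (\<forall>w\<in>cube \<rho>. w \<in> Y \<longleftrightarrow> \<theta> *\<^sub>R w \<in> Y)"
    if "\<epsilon> > 0" for \<epsilon>
  proof -
    have inf: "infinite (\<tau> ` K)" using K(1) \<open>inj \<tau>\<close> by (simp add: finite_image_iff inj_on_subset)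
    have sub: "\<tau> ` K \<subseteq> {1..real b'}" using \<tau> by auto
    note close = infinite_bounded_reals_close[OF inf sub that]
    obtain x y where "x \<in> \<tau> ` K" "y \<in> \<tau> ` K" "x < y" "y - x < \<epsilon>"
      by (rule close)
    then obtain l k where lk: "l \<in> K" "k \<in> K" "\<tau> l < \<tau> k" "\<tau> k - \<tau> l < \<epsilon>" by blast
    define \<theta> where "\<theta> = \<tau> l / \<tau> k"
    have pos: "\<tau> k > 0" "\<tau> l > 0" using \<tau>[of k] \<tau>[of l] by auto
    have "\<epsilon> \<le> \<epsilon> * \<tau> k" using that \<tau>(1)[of k] by simp
    then have "(1 - \<epsilon>) * \<tau> k < \<tau> l" using lk(4) by (simp add: left_diff_distrib)
    then have \<theta>: "1 - \<epsilon> < \<theta>" "0 < \<theta>" "\<theta> < 1"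
      using lk(3) pos by (simp_all add: \<theta>_def pos_less_divide_eq)
    have "w \<in> Y \<longleftrightarrow> \<theta> *\<^sub>R w \<in> Y" if "w \<in> cube \<rho>" for w
    proof -
      have "\<theta> *\<^sub>R w \<in> cube \<rho>" using \<theta> \<rho> by (intro scale_cube[OF that]) (simp add: mult_left_le_one_le)
      from transfer[OF lk(2) this]
      have "\<theta> *\<^sub>R w \<in> Y \<longleftrightarrow> q + (1 / real b ^ k0) *\<^sub>R (\<tau> l *\<^sub>R w) \<in> X"
        using pos by (simp add: \<theta>_def)
      then show ?thesis using transfer[OF lk(1) that] by simp
    qed
    then show ?thesis using \<theta> by blast
  qed
  have "conical_at q (\<rho> / c) X" unfolding conical_at_def
  proof (intro ballI allI impI)
    fix y :: "real ^ 'n" and s :: real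
    assume y: "y \<in> cube (\<rho> / c)" and s: "0 < s \<and> s \<le> 1"
    have "c *\<^sub>R y \<in> cube \<rho>" using c by (intro scale_cube[OF y]) simp
    from scaling_invariance_closure[OF \<open>closed Y\<close> ratios this, of s]
    have "c *\<^sub>R y \<in> Y \<longleftrightarrow> s *\<^sub>R (c *\<^sub>R y) \<in> Y" using s by blast
    then show "q + y \<in> X \<longleftrightarrow> q + s *\<^sub>R y \<in> X" using c by (simp add: Y_def)
  qed
  then show ?thesis using \<rho> c by (intro exI[of _ "\<rho> / c"]) simp
qed


lemma conical_atD:
  assumes "conical_at q r X" "y \<in> cube r" "0 < s" "s \<le> 1"
  shows "q + y \<in> X \<longleftrightarrow> q + s *\<^sub>R y \<in> X"
  using assms unfolding conical_at_def by blast

lemma conical_at_apex: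
  fixes X :: "(real ^ 'n) set"
  assumes "closed X" "conical_at q r X" "y \<in> cube r" "q + y \<in> X"
  shows "q \<in> X"
proof -
  define T where "T = {t :: real. q + t *\<^sub>R y \<in> X}"
  have "closed T"
    using continuous_closed_vimage[OF \<open>closed X\<close>, of "\<lambda>t :: real. q + t *\<^sub>R y"]
    by (simp add: T_def vimage_def)
  have "\<exists>t\<in>T. dist t 0 < \<epsilon>" if "\<epsilon> > 0" for \<epsilon>
  proof
    show "min 1 (\<epsilon> / 2) \<in> T"
      using conical_atD[OF assms(2,3), of "min 1 (\<epsilon> / 2)"] assms(4) that by (simp add: T_def)
  qed (use that in simp)
  then have "0 \<in> T" using \<open>closed T\<close> closed_approachable by blast
  then show ?thesis by (simp add: T_def)
qed

text \<open>
  A segment in the large cube is contracted into the small cube where X is known to be a cone.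
\<close>
lemma conical_at_extend:
  fixes q :: "real ^ 'n"
  assumes "conical_at q r0 X" "r0 > 0" "N > (1 :: real)"
    and contract: "\<And>y. y \<in> cube r \<Longrightarrow> q + y \<in> X \<longleftrightarrow> q + (1 / N) *\<^sub>R y \<in> X"
  shows "conical_at q r X"
  unfolding conical_at_def
proof (intro ballI allI impI)
  fix y :: "real ^ 'n" and s :: real
  assume y: "y \<in> cube r" and s: "0 < s \<and> s \<le> 1"
  have r: "0 \<le> r" using y by (auto simp: cube_def intro: order_trans[OF abs_ge_zero])
  have iter: "q + t *\<^sub>R y \<in> X \<longleftrightarrow> q + ((1 / N) ^ m * t) *\<^sub>R y \<in> X" if "0 \<le> t" "t \<le> 1" for t m
  proof (induction m)
    case (Suc m)
    have "(1 / N) ^ m * t \<le> 1" using that assms(3) by (intro mult_le_one power_le_one) auto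
    moreover have "0 \<le> (1 / N) ^ m * t" using that assms(3) by simp
    ultimately have "((1 / N) ^ m * t) *\<^sub>R y \<in> cube r"
      using r by (intro scale_cube[OF y]) (simp only: abs_of_nonneg mult_left_le_one_le)
    from contract[OF this] Suc show ?case by (simp add: mult.assoc)
  qed simp
  obtain m where m: "(1 / N) ^ m < r0 / (r + 1)"
    using real_arch_pow_inv[of "r0 / (r + 1)" "1 / N"] assms(2,3) r by auto
  have "(1 / N) ^ m * r \<le> r0"
  proof -
    have "(1 / N) ^ m * r \<le> r0 / (r + 1) * r" using m r by (intro mult_right_mono) auto
    also have "\<dots> \<le> r0" using r assms(2) by (simp add: field_simps)
    finally show ?thesis .
  qed
  then have "(1 / N) ^ m *\<^sub>R y \<in> cube r0"
    using assms(3) by (intro scale_cube[OF y]) simp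
  with assms(1) s have "q + (1 / N) ^ m *\<^sub>R y \<in> X \<longleftrightarrow> q + s *\<^sub>R ((1 / N) ^ m *\<^sub>R y) \<in> X"
    unfolding conical_at_def by blast
  then show "q + y \<in> X \<longleftrightarrow> q + s *\<^sub>R y \<in> X"
    using iter[of 1 m] iter[of s m] s by (simp add: mult.commute)
qed

section \<open>Cones around arbitrary points\<close>

text \<open>
  If the views of X at x agree for scales \<open>k < l\<close>, then X is locally invariant under the map that
  carries the cell of x at scale k to its cell at scale l. In the coordinates of the larger cell
  this is \<open>u \<mapsto> (u + c) / N\<close> with an integer vector c whose entries lie between 0 and
  \<open>N - 1\<close>; its fixed point \<open>c / (N - 1)\<close> is rational and lies in the same cell as x.
\<close>
lemma rational_conical_neighbourhood:
  fixes X :: "(real ^ 'n) set"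
  assumes b: "b > 1" and views: "finite_views b X"
    and conical: "\<And>q. rational_point q \<Longrightarrow> \<exists>r>0. conical_at q r X"
  shows "\<exists>q r. rational_point q \<and> r \<in> \<rat> \<and> r > 0 \<and> conical_at q r X \<and> (\<forall>i. \<bar>x $ i - q $ i\<bar> < r)"
proof -
  define V where "V k = view b X k (anchor b x k)" for k
  have "finite (range V)" unfolding V_def by (rule finite_view_range[OF views])
  then have "\<not> inj V" using finite_imageD by blast
  then obtain k l where "V k = V l" "k < l"
    unfolding inj_def by (metis linorder_neqE_nat)
  define N where "N = real b ^ (l - k)"
  have "N > 1" unfolding N_def using b \<open>k < l\<close> by (intro one_less_power) auto
  have bk: "real b ^ k > 0" using b by simp
  have bl: "real b ^ l = real b ^ k * N" unfolding N_def using \<open>k < l\<close> by (simp add: power_add[symmetric])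
  define a where "a = anchor b x k"
  define c where "c = real_vec (anchor b x l) - N *\<^sub>R real_vec a"
  define p where "p = (1 / (N - 1)) *\<^sub>R c"
  define q where "q = (1 / real b ^ k) *\<^sub>R (p + real_vec a)"
  have p01: "0 \<le> p $ i \<and> p $ i \<le> 1" for i
  proof -
    define t where "t = real b ^ k * x $ i"
    have N: "N = real_of_int (int b ^ (l - k))" by (simp add: N_def)
    have a_i: "a $ i = \<lfloor>t\<rfloor>" and l_i: "anchor b x l $ i = \<lfloor>N * t\<rfloor>"
      by (simp_all add: a_def anchor_def t_def bl mult_ac)
    have "N * \<lfloor>t\<rfloor> \<le> N * t" using \<open>N > 1\<close> by (intro mult_left_mono) auto
    then have "int b ^ (l - k) * \<lfloor>t\<rfloor> \<le> \<lfloor>N * t\<rfloor>" by (simp add: le_floor_iff N_def)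
    then have 1: "N * \<lfloor>t\<rfloor> \<le> \<lfloor>N * t\<rfloor>" unfolding N of_int_mult[symmetric] of_int_le_iff by simp
    have "N * t < N * (\<lfloor>t\<rfloor> + 1)" using \<open>N > 1\<close> by (intro mult_strict_left_mono) linarith+
    then have "\<lfloor>N * t\<rfloor> < int b ^ (l - k) * (\<lfloor>t\<rfloor> + 1)" by (simp add: floor_less_iff N_def)
    then have "\<lfloor>N * t\<rfloor> + 1 \<le> int b ^ (l - k) * (\<lfloor>t\<rfloor> + 1)" by simp
    then have "real_of_int (\<lfloor>N * t\<rfloor> + 1) \<le> real_of_int (int b ^ (l - k) * (\<lfloor>t\<rfloor> + 1))"
      by (simp only: of_int_le_iff)
    then have 2: "\<lfloor>N * t\<rfloor> \<le> N * \<lfloor>t\<rfloor> + (N - 1)" by (simp add: N_def algebra_simps)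
    have "c $ i = \<lfloor>N * t\<rfloor> - N * \<lfloor>t\<rfloor>" by (simp add: c_def a_i l_i)
    then show ?thesis using 1 2 \<open>N > 1\<close> by (simp add: p_def field_simps)
  qed
  have "rational_point q"
    by (auto simp: rational_point_def q_def p_def c_def N_def)
  define r where "r = 2 / real b ^ k"
  have r: "r \<in> \<rat>" "r > 0" using b by (auto simp: r_def)
  have fixpoint: "p + real_vec (anchor b x l) = N *\<^sub>R (p + real_vec a)"
  proof -
    have "(N - 1) *\<^sub>R p = c" using \<open>N > 1\<close> by (simp add: p_def)
    then show ?thesis by (simp add: c_def algebra_simps)
  qed
  have "q + y \<in> X \<longleftrightarrow> q + (1 / N) *\<^sub>R y \<in> X" if "y \<in> cube r" for y
  proof -
    define z where "z = real b ^ k *\<^sub>R y"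
    have z: "z \<in> cube 2" unfolding z_def using bk by (intro scale_cube[OF that]) (simp add: r_def)
    have "p + z \<in> window" unfolding cube_def
    proof clarify
      fix i
      have "\<bar>z $ i\<bar> \<le> 2" using z by (simp add: cube_def)
      then show "\<bar>(p + z) $ i\<bar> \<le> 3" using p01[of i] unfolding vector_add_component by linarith
    qed
    with \<open>V k = V l\<close> have "(1 / real b ^ k) *\<^sub>R ((p + z) + real_vec a) \<in> X \<longleftrightarrow>
        (1 / real b ^ l) *\<^sub>R ((p + z) + real_vec (anchor b x l)) \<in> X"
      unfolding V_def a_def by (rule equal_viewsD)
    moreover have "(1 / real b ^ k) *\<^sub>R ((p + z) + real_vec a) = q + y"
      using b by (simp add: q_def z_def algebra_simps)
    moreover have "(1 / real b ^ l) *\<^sub>R ((p + z) + real_vec (anchor b x l)) = q + (1 / N) *\<^sub>R y"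
    proof -
      have shift: "(p + z) + real_vec (anchor b x l) = N *\<^sub>R (p + real_vec a) + z"
        using fixpoint by (simp add: algebra_simps)
      show ?thesis unfolding shift scaleR_add_right[of _ "N *\<^sub>R (p + real_vec a)"]
        using b \<open>N > 1\<close> by (simp add: q_def z_def bl)
    qed
    ultimately show ?thesis by simp
  qed
  moreover obtain r0 where "r0 > 0" "conical_at q r0 X" using conical \<open>rational_point q\<close> by blast
  ultimately have "conical_at q r X" using \<open>N > 1\<close> by (intro conical_at_extend[of q r0 X N r])
  moreover have "\<bar>x $ i - q $ i\<bar> < r" for i
  proof -
    have "x $ i - q $ i = (offset b x k $ i - p $ i) / real b ^ k"
      using b by (simp add: offset_def q_def a_def field_simps)
    moreover have "\<bar>offset b x k $ i - p $ i\<bar> < 2" using offset_bounds[of b x k i] p01[of i] by linarith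
    ultimately show ?thesis using bk by (simp add: r_def abs_divide divide_strict_right_mono)
  qed
  ultimately show ?thesis using \<open>rational_point q\<close> r by blast
qed

section \<open>Assembling polytopes by induction on the dimension\<close>

definition rational_polytopal :: "(real ^ 'n) set \<Rightarrow> bool" where
  "rational_polytopal X \<longleftrightarrow> (\<exists>\<P>. finite \<P> \<and> (\<forall>P\<in>\<P>. rational_polytope P) \<and> X = \<Union>\<P>)"

lemma rational_polytopal_UN:
  assumes "finite A" "\<And>x. x \<in> A \<Longrightarrow> rational_polytopal (Y x)"
  shows "rational_polytopal (\<Union>x\<in>A. Y x)"
proof -
  from assms(2) obtain \<P> where
    \<P>: "\<And>x. x \<in> A \<Longrightarrow> finite (\<P> x) \<and> (\<forall>P\<in>\<P> x. rational_polytope P) \<and> Y x = \<Union>(\<P> x)"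
    unfolding rational_polytopal_def by metis
  then show ?thesis unfolding rational_polytopal_def using assms(1)
    by (intro exI[of _ "\<Union>x\<in>A. \<P> x"]) auto
qed

lemma rational_polytopal_Un:
  assumes "rational_polytopal X" "rational_polytopal Y"
  shows "rational_polytopal (X \<union> Y)"
  using rational_polytopal_UN[of "{X, Y}" "\<lambda>Z. Z"] assms by auto

lemma rational_polytopal_Int_singleton:
  assumes "rational_point q"
  shows "rational_polytopal (X \<inter> {q})"
proof -
  have "rational_polytope {q}" unfolding rational_polytope_iff
    using assms by (intro exI[of _ "{q}"]) simp
  then show ?thesis unfolding rational_polytopal_def
    by (intro exI[of _ "if q \<in> X then {{q}} else {}"]) auto
qed

lemma rational_polytopal_cone:
  assumes "rational_point q" "rational_polytopal Y"
  shows "rational_polytopal (\<Union>y\<in>Y. closed_segment q y)"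
proof -
  from assms(2) obtain \<P> where \<P>: "finite \<P>" "\<forall>P\<in>\<P>. rational_polytope P" "Y = \<Union>\<P>"
    unfolding rational_polytopal_def by blast
  have "rational_polytope (\<Union>y\<in>P. closed_segment q y)" if "P \<in> \<P>" for P
  proof -
    from \<P>(2) that obtain S where S: "finite S" "\<forall>v\<in>S. rational_point v" "P = convex hull S"
      unfolding rational_polytope_iff by blast
    show ?thesis
    proof (cases "S = {}")
      case True
      then show ?thesis unfolding rational_polytope_iff using S by (intro exI[of _ "{}"]) simp
    next
      case False
      then have "(\<Union>y\<in>P. closed_segment q y) = convex hull (insert q S)"
        by (simp add: S(3) convex_hull_insert_segments)
      then show ?thesis unfolding rational_polytope_iff using S assms(1)
        by (intro exI[of _ "insert q S"]) simp
    qed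
  qed
  then show ?thesis unfolding rational_polytopal_def using \<P>(1,3)
    by (intro exI[of _ "(\<lambda>P. \<Union>y\<in>P. closed_segment q y) ` \<P>"]) auto
qed

lemma rational_polyhedron_coordinate:
  assumes "c \<in> \<rat>"
  shows "rational_polyhedron {x :: real ^ 'n. x $ j \<le> c}" "rational_polyhedron {x :: real ^ 'n. c \<le> x $ j}"
proof -
  have "rational_polyhedron {x :: real ^ 'n. axis j 1 \<bullet> x \<le> c}"
    "rational_polyhedron {x :: real ^ 'n. (- axis j 1) \<bullet> x \<le> - c}"
    using assms by (intro rational_polyhedron_halfspace; auto simp: rational_point_def axis_def)+
  then show "rational_polyhedron {x :: real ^ 'n. x $ j \<le> c}" "rational_polyhedron {x :: real ^ 'n. c \<le> x $ j}"
    by (simp_all add: inner_axis')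
qed

text \<open>
  If the i-th coordinate is constant on X then it is constant along the segments towards the
  apex, so the ray through a point of X leaves the cube through a face of a direction in I. Thus
  only those faces are needed, and the induction below has fewer free directions on each of them.
\<close>
lemma conical_piece_eq_cone_over_faces:
  fixes X :: "(real ^ 'n) set"
  assumes "closed X" "conical_at q r X" "r > 0"
    and const: "\<And>i. i \<notin> I \<Longrightarrow> \<exists>c. \<forall>x\<in>X. x $ i = c"
  defines "B \<equiv> {x. x - q \<in> cube r}"
  shows "X \<inter> B = (X \<inter> {q}) \<union>
    (\<Union>(j, c) \<in> (\<Union>j\<in>I. {(j, q $ j - r), (j, q $ j + r)}).
      \<Union>y \<in> X \<inter> B \<inter> {y. y $ j = c}. closed_segment q y)"
proof (intro set_eqI iffI)
  fix z assume z: "z \<in> X \<inter> B"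
  show "z \<in> (X \<inter> {q}) \<union>
    (\<Union>(j, c) \<in> (\<Union>j\<in>I. {(j, q $ j - r), (j, q $ j + r)}).
      \<Union>y \<in> X \<inter> B \<inter> {y. y $ j = c}. closed_segment q y)"
  proof (cases "z = q")
    case True
    then show ?thesis using z by simp
  next
    case False
    define t where "t = Max (range (\<lambda>i. \<bar>(z - q) $ i\<bar>))"
    have t_ge: "\<bar>(z - q) $ i\<bar> \<le> t" for i unfolding t_def by (rule Max_ge) auto
    have "t \<in> range (\<lambda>i. \<bar>(z - q) $ i\<bar>)" unfolding t_def by (rule Max_in) auto
    then obtain j where j: "t = \<bar>(z - q) $ j\<bar>" by blast
    from False obtain i where "(z - q) $ i \<noteq> 0" by (auto simp: vec_eq_iff)
    then have "t > 0" using t_ge[of i] by auto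
    have "t \<le> r" using z unfolding j B_def cube_def by blast
    define y where "y = (r / t) *\<^sub>R (z - q)"
    have y: "y \<in> cube r" unfolding y_def
      using t_ge \<open>t > 0\<close> \<open>r > 0\<close> by (intro scale_cube[of _ t]) (auto simp: cube_def)
    have zy: "q + (t / r) *\<^sub>R y = z" using \<open>t > 0\<close> \<open>r > 0\<close> by (simp add: y_def)
    have "q + y \<in> X"
      using conical_atD[OF assms(2) y, of "t / r"] zy z \<open>t > 0\<close> \<open>r > 0\<close> \<open>t \<le> r\<close> by simp
    moreover have "q + y \<in> B" using y by (simp add: B_def)
    moreover have "j \<in> I"
    proof (rule ccontr)
      assume "j \<notin> I"
      then obtain c where c: "\<forall>x\<in>X. x $ j = c" using const by blast
      have "q + (1 / 2) *\<^sub>R y \<in> X"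
        using conical_atD[OF assms(2) y, of "1 / 2"] \<open>q + y \<in> X\<close> by simp
      then have "(q + y) $ j = (q + (1 / 2) *\<^sub>R y) $ j" using c \<open>q + y \<in> X\<close> by metis
      then have "y $ j = 0" by simp
      then show False using \<open>t > 0\<close> \<open>r > 0\<close> j by (simp add: y_def)
    qed
    moreover have "(q + y) $ j = q $ j - r \<or> (q + y) $ j = q $ j + r"
    proof -
      have "\<bar>y $ j\<bar> = r" using j \<open>t > 0\<close> \<open>r > 0\<close> by (simp add: y_def abs_mult)
      then show ?thesis by auto
    qed
    moreover have "z \<in> closed_segment q (q + y)"
      unfolding in_segment using \<open>t > 0\<close> \<open>r > 0\<close> \<open>t \<le> r\<close> zy
      by (intro exI[of _ "t / r"]) (auto simp: algebra_simps)
    ultimately show ?thesis by blast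
  qed
next
  fix z assume z: "z \<in> (X \<inter> {q}) \<union>
    (\<Union>(j, c) \<in> (\<Union>j\<in>I. {(j, q $ j - r), (j, q $ j + r)}).
      \<Union>y \<in> X \<inter> B \<inter> {y. y $ j = c}. closed_segment q y)"
  show "z \<in> X \<inter> B"
  proof (cases "z = q")
    case True
    have "q \<in> X"
    proof (rule ccontr)
      assume "q \<notin> X"
      with z True obtain y where y: "y \<in> X" "y - q \<in> cube r" by (auto simp: B_def)
      with conical_at_apex[OF assms(1,2) y(2)] \<open>q \<notin> X\<close> show False by simp
    qed
    then show ?thesis using True \<open>r > 0\<close> by (auto simp: B_def cube_def)
  next
    case False
    with z obtain y where y: "y \<in> X" "y \<in> B" "z \<in> closed_segment q y" by auto
    then obtain s where s: "0 \<le> s" "s \<le> 1" "z = (1 - s) *\<^sub>R q + s *\<^sub>R y" by (auto simp: in_segment)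
    have z_eq: "z = q + s *\<^sub>R (y - q)" unfolding s(3) by (simp add: algebra_simps)
    have "y - q \<in> cube r" using y(2) by (simp add: B_def)
    have "s > 0" using False s(1) z_eq by (cases "s = 0") auto
    have "z \<in> X" unfolding z_eq
      using conical_atD[OF assms(2) \<open>y - q \<in> cube r\<close> \<open>s > 0\<close> s(2)] y(1) by simp
    moreover have "z - q \<in> cube r" unfolding z_eq
      using s \<open>r > 0\<close> by (simp add: scale_cube[OF \<open>y - q \<in> cube r\<close>] mult_left_le_one_le)
    ultimately show ?thesis by (simp add: B_def)
  qed
qed


text \<open>
  The induction is on a set I of directions outside of which X is confined to coordinate
  hyperplanes, which replaces an induction on the dimension of the ambient space. Intersecting X with a face of a
  rational cube keeps the views finite, since rational polyhedra have finitely many views.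
\<close>
theorem rational_polytopal_if_finite_views:
  fixes X :: "(real ^ 'n) set"
  assumes b: "b > 1" and b': "b' > 1" and indep: "mult_independent (real b) (real b')"
    and "compact X" "finite_views b X" "finite_views b' X"
    and "\<And>i. i \<notin> I \<Longrightarrow> \<exists>c. \<forall>x\<in>X. x $ i = c"
  shows "rational_polytopal X"
  using finite[of I] assms(4-7)
proof (induction I arbitrary: X rule: finite_psubset_induct)
  case (psubset I X)
  have "closed X" using psubset.prems(1) by (rule compact_imp_closed)
  have "\<exists>q r. rational_point q \<and> r \<in> \<rat> \<and> r > 0 \<and> conical_at q r X \<and> (\<forall>i. \<bar>x $ i - q $ i\<bar> < r)" for x
    using rational_point_conical[OF b b' indep \<open>closed X\<close> psubset.prems(2,3)]
    by (intro rational_conical_neighbourhood[OF b psubset.prems(2)])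
  then obtain q r where
    q: "\<And>x. rational_point (q x)" and r: "\<And>x. r x \<in> \<rat>" "\<And>x. r x > 0" and
    con: "\<And>x. conical_at (q x) (r x) X" and near: "\<And>x i. \<bar>x $ i - q x $ i\<bar> < r x" by metis
  define U where "U x = box (\<chi> i. q x $ i - r x) (\<chi> i. q x $ i + r x)" for x
  define B where "B x = {z. z - q x \<in> cube (r x)}" for x
  have "open (U x)" for x unfolding U_def by (rule open_box)
  moreover have "X \<subseteq> (\<Union>x\<in>X. U x)"
  proof
    fix x assume "x \<in> X"
    have "q x $ i - r x < x $ i \<and> x $ i < q x $ i + r x" for i using near[of x i] by linarith
    then have "x \<in> U x" by (simp add: U_def mem_box_cart)
    with \<open>x \<in> X\<close> show "x \<in> (\<Union>x\<in>X. U x)" by blast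
  qed
  ultimately obtain D where D: "D \<subseteq> X" "finite D" "X \<subseteq> (\<Union>x\<in>D. U x)"
    using compactE_image[OF psubset.prems(1)] by metis
  have U_B: "U x \<subseteq> B x" for x
  proof
    fix z assume "z \<in> U x"
    have "\<bar>z $ i - q x $ i\<bar> \<le> r x" for i
    proof -
      have "q x $ i - r x < z $ i \<and> z $ i < q x $ i + r x"
        using \<open>z \<in> U x\<close> by (simp add: U_def mem_box_cart)
      then show ?thesis by linarith
    qed
    then show "z \<in> B x" by (simp add: B_def cube_def)
  qed
  have "X \<subseteq> (\<Union>x\<in>D. X \<inter> B x)"
  proof
    fix z assume "z \<in> X"
    with D(3) obtain x where "x \<in> D" "z \<in> U x" by blast
    with U_B \<open>z \<in> X\<close> show "z \<in> (\<Union>x\<in>D. X \<inter> B x)" by blast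
  qed
  then have X_eq: "X = (\<Union>x\<in>D. X \<inter> B x)" by (intro equalityI) auto
  have piece: "rational_polytopal (X \<inter> B x)" for x
  proof -
    have B_eq: "B x = (\<Inter>i\<in>UNIV. {z. q x $ i - r x \<le> z $ i} \<inter> {z. z $ i \<le> q x $ i + r x})"
    proof -
      have "\<bar>(z - q x) $ i\<bar> \<le> r x \<longleftrightarrow> q x $ i - r x \<le> z $ i \<and> z $ i \<le> q x $ i + r x" for z i
        unfolding vector_minus_component by linarith
      then show ?thesis unfolding B_def cube_def by blast
    qed
    have q_rat: "q x $ i - r x \<in> \<rat>" "q x $ i + r x \<in> \<rat>" for i
      using q[of x] r(1)[of x] by (auto simp: rational_point_def)
    have B_rat: "rational_polyhedron (B x)" unfolding B_eq
      by (intro rational_polyhedron_INT rational_polyhedron_Int rational_polyhedron_coordinate q_rat) simp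
    have face: "rational_polytopal (X \<inter> B x \<inter> {y. y $ j = c})" if "j \<in> I" "c \<in> \<rat>" for j c
    proof (rule psubset.IH)
      show "I - {j} \<subset> I" using that(1) by blast
      have H: "{y :: real ^ 'n. y $ j = c} = {y. y $ j \<le> c} \<inter> {y. c \<le> y $ j}" by auto
      have slab: "rational_polyhedron (B x \<inter> {y. y $ j = c})" unfolding H
        using that(2) by (intro rational_polyhedron_Int rational_polyhedron_coordinate B_rat)
      then show "finite_views b (X \<inter> B x \<inter> {y. y $ j = c})" "finite_views b' (X \<inter> B x \<inter> {y. y $ j = c})"
        unfolding Int_assoc using psubset.prems(2,3) b b'
        by (simp_all add: finite_views_Int finite_views_rational_polyhedron)
      have "closed (B x \<inter> {y. y $ j = c})" unfolding B_eq H
        by (intro closed_Int closed_INT ballI closed_halfspace_component_le_cart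
            closed_halfspace_component_ge_cart)
      then show "compact (X \<inter> B x \<inter> {y. y $ j = c})"
        unfolding Int_assoc using psubset.prems(1) by (intro compact_Int_closed)
      show "\<exists>d. \<forall>y\<in>X \<inter> B x \<inter> {y. y $ j = c}. y $ i = d" if "i \<notin> I - {j}" for i
        using that psubset.prems(4)[of i] by (cases "i = j") auto
    qed
    have "X \<inter> B x = (X \<inter> {q x}) \<union>
      (\<Union>(j, c) \<in> (\<Union>j\<in>I. {(j, q x $ j - r x), (j, q x $ j + r x)}).
        \<Union>y \<in> X \<inter> B x \<inter> {y. y $ j = c}. closed_segment (q x) y)"
      unfolding B_def
      by (rule conical_piece_eq_cone_over_faces[OF \<open>closed X\<close> con r(2) psubset.prems(4)])
    also have "rational_polytopal \<dots>"
    proof (intro rational_polytopal_Un rational_polytopal_Int_singleton rational_polytopal_UN q)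
      show "finite (\<Union>j\<in>I. {(j, q x $ j - r x), (j, q x $ j + r x)})" by simp
    next
      fix f assume "f \<in> (\<Union>j\<in>I. {(j, q x $ j - r x), (j, q x $ j + r x)})"
      then obtain j c where f: "f = (j, c)" "j \<in> I" "c \<in> \<rat>" using q_rat by auto
      show "rational_polytopal (case f of (j, c) \<Rightarrow>
          \<Union>y \<in> X \<inter> B x \<inter> {y. y $ j = c}. closed_segment (q x) y)"
        unfolding f(1) prod.case by (intro rational_polytopal_cone q face f)
    qed
    finally show ?thesis .
  qed
  show ?case by (subst X_eq) (intro rational_polytopal_UN D(2) piece)
qed

theorem mainTheorem3:
  fixes b b' :: nat and X :: "(real ^ 'n) set"
  assumes "b > 1" and "b' > 1"
    and "mult_independent (real b) (real b')"
    and "compact X" and "X \<subseteq> unit_cube"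
  shows "b_self_similar b X \<and> b_self_similar b' X \<longleftrightarrow>
    (\<exists>\<P>. finite \<P> \<and> (\<forall>P\<in>\<P>. rational_polytope P) \<and> X = \<Union>\<P>)"
proof
  assume "b_self_similar b X \<and> b_self_similar b' X"
  then have "finite_views b X" "finite_views b' X"
    using assms by (auto intro!: finite_views_if_b_self_similar)
  then have "rational_polytopal X"
    using rational_polytopal_if_finite_views[OF assms(1-4), of UNIV] by simp
  then show "\<exists>\<P>. finite \<P> \<and> (\<forall>P\<in>\<P>. rational_polytope P) \<and> X = \<Union>\<P>"
    by (simp add: rational_polytopal_def)
next
  assume "\<exists>\<P>. finite \<P> \<and> (\<forall>P\<in>\<P>. rational_polytope P) \<and> X = \<Union>\<P>"
  then obtain \<P> where \<P>: "finite \<P>" "\<And>P. P \<in> \<P> \<Longrightarrow> rational_polytope P" "X = \<Union>\<P>" by blast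
  have "finite_views c X" if "c > 0" for c
    unfolding \<P>(3) by (intro finite_views_Union finite_views_rational_polytope \<P>(1,2) that)
  then show "b_self_similar b X \<and> b_self_similar b' X"
    using assms by (auto intro!: b_self_similar_if_finite_views)
qed

end
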